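(* Let $U=(U_{i,j})\in\prod_{1\le i<j\le k}M_{r_i,r_j}(\mathcal{O}(\mathbf{C}^*,0))$. Then there exists $F\in\mathfrak{G}(\mathcal{O}(\mathbf{C}^*,0))$ such that $F[A_U]=A_V$ with $V=(V_{i,j})\in\prod_{1\le i<j\le k}M_{r_i,r_j}(\mathbf{C}(\{z\}))$.
   Context: Fix $q\in\mathbf{C}$ with $|q|>1$; $\sigma_q f(z)=f(qz)$, applied entrywise. $\mathcal{O}(\mathbf{C}^*,0)$ is the ring of germs of holomorphic functions in a punctured neighbourhood of $0$ (essential singularities at $0$ allowed); $\mathbf{C}(\{z\})$ is the fraction field of the ring of convergent power series. Fix integers $\mu_1>\cdots>\mu_k$, ranks $r_1,\dots,r_k\ge1$, matrices $A_i\in GL_{r_i}(\mathbf{C})$, $n=\sum r_i$. For a family $U=(U_{i,j})_{1\le i<j\le k}$ of $r_i\times r_j$ matrices, $A_U$ is the block upper triangular matrix with diagonal blocks $z^{-\mu_i}A_i$ and $(i,j)$-block $U_{i,j}$ for $i<j$. $\mathfrak{G}\subset GL_n$ is the group of block upper triangular matrices with diagonal blocks $I_{r_1},\dots,I_{r_k}$; $F[A]=(\sigma_qF)AF^{-1}$. *)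

theory Defs
  imports
    "HOL-Complex_Analysis.Complex_Analysis"
    "Jordan_Normal_Form.Determinant"
begin

section \<open>The ring of germs of holomorphic functions in a punctured neighbourhood of 0\<close>

text \<open>
  The value of a representative at \<open>0\<close> is irrelevant: two representatives are identified iff they
  agree on some punctured neighbourhood of \<open>0\<close>. By definition, \<^term>\<open>isolated_singularity_at f 0\<close>
  says only that \<open>f\<close> is analytic on some punctured ball around \<open>0\<close>; essential singularities are
  allowed.
\<close>

definition germ_rel :: "(complex \<Rightarrow> complex) \<Rightarrow> (complex \<Rightarrow> complex) \<Rightarrow> bool" where
  "germ_rel f g \<longleftrightarrow> isolated_singularity_at f 0 \<and> isolated_singularity_at g 0 \<and>
     eventually (\<lambda>z. f z = g z) (at 0)"

lemma part_equivp_germ_rel: "part_equivp germ_rel"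
proof (rule part_equivpI)
  show "\<exists>f. germ_rel f f"
    by (rule exI[of _ "\<lambda>_. 0"]) (simp add: germ_rel_def isolated_singularity_at_const)
  show "symp germ_rel"
    by (rule sympI) (auto simp: germ_rel_def elim: eventually_mono)
  show "transp germ_rel"
    by (rule transpI) (auto simp: germ_rel_def elim: eventually_elim2)
qed

quotient_type germ = "complex \<Rightarrow> complex" / partial: germ_rel
  by (rule part_equivp_germ_rel)

instantiation germ :: comm_ring_1
begin

lift_definition zero_germ :: germ is "\<lambda>_. 0"
  by (simp add: germ_rel_def isolated_singularity_at_const)

lift_definition one_germ :: germ is "\<lambda>_. 1"
  by (simp add: germ_rel_def isolated_singularity_at_const)

lift_definition plus_germ :: "germ \<Rightarrow> germ \<Rightarrow> germ" is "\<lambda>f g z. f z + g z"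
  by (auto simp: germ_rel_def intro!: isolated_singularity_at_add elim: eventually_elim2)

lift_definition minus_germ :: "germ \<Rightarrow> germ \<Rightarrow> germ" is "\<lambda>f g z. f z - g z"
  by (auto simp: germ_rel_def intro!: isolated_singularity_at_minus elim: eventually_elim2)

lift_definition uminus_germ :: "germ \<Rightarrow> germ" is "\<lambda>f z. - f z"
  by (auto simp: germ_rel_def intro!: isolated_singularity_at_uminus elim: eventually_mono)

lift_definition times_germ :: "germ \<Rightarrow> germ \<Rightarrow> germ" is "\<lambda>f g z. f z * g z"
  by (auto simp: germ_rel_def intro!: isolated_singularity_at_times elim: eventually_elim2)

instance
proof
  fix a b c :: germ
  show "a * b * c = a * (b * c)"
    by transfer (simp add: germ_rel_def isolated_singularity_at_times mult.assoc)
  show "a * b = b * a"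
    by transfer (simp add: germ_rel_def isolated_singularity_at_times mult.commute)
  show "1 * a = a"
    by transfer (simp add: germ_rel_def)
  show "a + b + c = a + (b + c)"
    by transfer (simp add: germ_rel_def isolated_singularity_at_add add.assoc)
  show "a + b = b + a"
    by transfer (simp add: germ_rel_def isolated_singularity_at_add add.commute)
  show "0 + a = a"
    by transfer (simp add: germ_rel_def)
  show "- a + a = 0"
    by transfer (simp add: germ_rel_def isolated_singularity_at_const)
  show "a - b = a + - b"
    by transfer (simp add: germ_rel_def isolated_singularity_at_minus)
  show "(a + b) * c = a * c + b * c"
    by transfer (simp add: germ_rel_def isolated_singularity_at_times isolated_singularity_at_add
        distrib_right)
  show "(0 :: germ) \<noteq> 1"
    by transfer (simp add: germ_rel_def)
qed

end

lift_definition const_germ :: "complex \<Rightarrow> germ" is "\<lambda>c _. c"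
  by (simp add: germ_rel_def isolated_singularity_at_const)

lift_definition z_powi_germ :: "int \<Rightarrow> germ" is "\<lambda>m z. z powi m"
  by (auto simp: germ_rel_def eventually_at_filter
        intro!: isolated_singularity_at_powr isolated_singularity_at_id)

lemma filterlim_scale_at_0:
  assumes "q \<noteq> (0::complex)"
  shows "filterlim (\<lambda>z. q * z) (at 0) (at 0)"
  using assms by (auto intro!: filterlim_atI tendsto_eq_intros simp: eventually_at_filter)

text \<open>
  For \<open>q = 0\<close> the germ of \<open>z \<mapsto> f (q z)\<close> would depend on the representative, so an
  arbitrary value is used there.
\<close>

lift_definition sigma :: "complex \<Rightarrow> germ \<Rightarrow> germ"
  is "\<lambda>q f. if q = 0 then (\<lambda>_. 0) else (\<lambda>z. f (q * z))"
proof -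
  fix q :: complex and f g :: "complex \<Rightarrow> complex"
  assume "germ_rel f g"
  hence f: "isolated_singularity_at f 0" and g: "isolated_singularity_at g 0"
    and ev: "eventually (\<lambda>z. f z = g z) (at 0)"
    by (auto simp: germ_rel_def)
  have iso: "isolated_singularity_at (\<lambda>z. h (q * z)) 0"
    if "isolated_singularity_at h 0" for h
    by (rule isolated_singularity_at_compose) (use that in \<open>simp_all add: analytic_on_mult\<close>)
  have ev': "eventually (\<lambda>z. f (q * z) = g (q * z)) (at 0)" if "q \<noteq> 0"
    by (rule eventually_compose_filterlim[OF ev filterlim_scale_at_0[OF that]])
  show "germ_rel (if q = 0 then (\<lambda>_. 0) else (\<lambda>z. f (q * z)))
                 (if q = 0 then (\<lambda>_. 0) else (\<lambda>z. g (q * z)))"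
    using iso[OF f] iso[OF g] ev' by (simp add: germ_rel_def isolated_singularity_at_const)
qed

text \<open>
  The field of fractions of the ring of convergent power series, as a subset of the ring of germs:
  the germs of quotients of sums of convergent power series.
\<close>

lift_definition is_convergent_fraction :: "germ \<Rightarrow> bool" is
  "\<lambda>f. \<exists>a b :: complex fps. fps_conv_radius a > 0 \<and> fps_conv_radius b > 0 \<and> b \<noteq> 0 \<and>
         eventually (\<lambda>z. f z = eval_fps a z / eval_fps b z) (at 0)"
proof -
  have *: "\<exists>a b :: complex fps. fps_conv_radius a > 0 \<and> fps_conv_radius b > 0 \<and> b \<noteq> 0 \<and>
             eventually (\<lambda>z. g z = eval_fps a z / eval_fps b z) (at 0)"
    if "eventually (\<lambda>z. f z = g z) (at 0)"
      and "\<exists>a b :: complex fps. fps_conv_radius a > 0 \<and> fps_conv_radius b > 0 \<and> b \<noteq> 0 \<and>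
             eventually (\<lambda>z. f z = eval_fps a z / eval_fps b z) (at 0)"
    for f g :: "complex \<Rightarrow> complex"
  proof -
    from that(2) obtain a b :: "complex fps" where
      ab: "fps_conv_radius a > 0" "fps_conv_radius b > 0" "b \<noteq> 0"
      and ev: "eventually (\<lambda>z. f z = eval_fps a z / eval_fps b z) (at 0)" by blast
    have "eventually (\<lambda>z. g z = eval_fps a z / eval_fps b z) (at 0)"
      using that(1) ev by eventually_elim simp
    with ab show ?thesis by blast
  qed
  fix f g :: "complex \<Rightarrow> complex"
  assume "germ_rel f g"
  hence fg: "eventually (\<lambda>z. f z = g z) (at 0)" by (simp add: germ_rel_def)
  hence gf: "eventually (\<lambda>z. g z = f z) (at 0)" by (rule eventually_mono) simp
  show "(\<exists>a b :: complex fps. fps_conv_radius a > 0 \<and> fps_conv_radius b > 0 \<and> b \<noteq> 0 \<and>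
           eventually (\<lambda>z. f z = eval_fps a z / eval_fps b z) (at 0)) \<longleftrightarrow>
        (\<exists>a b :: complex fps. fps_conv_radius a > 0 \<and> fps_conv_radius b > 0 \<and> b \<noteq> 0 \<and>
           eventually (\<lambda>z. g z = eval_fps a z / eval_fps b z) (at 0))"
    using *[OF fg] *[OF gf] by blast
qed

definition convergent_fractions :: "germ set" where
  "convergent_fractions = {f. is_convergent_fraction f}"


section \<open>Block matrices\<close>

text \<open>
  Blocks are numbered \<open>0, \<dots>, k - 1\<close>. Row (or column) \<open>p\<close> of a block matrix with block sizes
  \<open>r 0, \<dots>, r (k - 1)\<close> lies in block \<^term>\<open>block_of r p\<close>, at position
  \<^term>\<open>p - block_start r (block_of r p)\<close> inside it.
\<close>

definition block_start :: "(nat \<Rightarrow> nat) \<Rightarrow> nat \<Rightarrow> nat" where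
  "block_start r i = (\<Sum>l<i. r l)"

definition block_of :: "(nat \<Rightarrow> nat) \<Rightarrow> nat \<Rightarrow> nat" where
  "block_of r p = (LEAST i. p < block_start r (Suc i))"

definition block_mat :: "nat \<Rightarrow> (nat \<Rightarrow> nat) \<Rightarrow> (nat \<Rightarrow> nat \<Rightarrow> 'a mat) \<Rightarrow> 'a mat" where
  "block_mat k r B = mat (\<Sum>i<k. r i) (\<Sum>i<k. r i) (\<lambda>(p, s).
     B (block_of r p) (block_of r s) $$
       (p - block_start r (block_of r p), s - block_start r (block_of r s)))"

definition upper_block_mat ::
  "nat \<Rightarrow> (nat \<Rightarrow> nat) \<Rightarrow> (nat \<Rightarrow> 'a::zero mat) \<Rightarrow> (nat \<Rightarrow> nat \<Rightarrow> 'a mat) \<Rightarrow> 'a mat" where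
  "upper_block_mat k r D U = block_mat k r (\<lambda>i j.
     if i = j then D i else if i < j then U i j else 0\<^sub>m (r i) (r j))"

text \<open>
  Families of \<open>r i \<times> r j\<close> matrices over \<open>S\<close>, for \<open>i < j < k\<close>; the values at other
  index pairs are irrelevant.
\<close>

definition upper_families :: "nat \<Rightarrow> (nat \<Rightarrow> nat) \<Rightarrow> 'a set \<Rightarrow> (nat \<Rightarrow> nat \<Rightarrow> 'a mat) set" where
  "upper_families k r S =
     {U. \<forall>i j. i < j \<and> j < k \<longrightarrow> U i j \<in> carrier_mat (r i) (r j) \<and> elements_mat (U i j) \<subseteq> S}"

definition unipotent_group :: "nat \<Rightarrow> (nat \<Rightarrow> nat) \<Rightarrow> 'a::comm_ring_1 mat set" where
  "unipotent_group k r =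
     {upper_block_mat k r (\<lambda>i. 1\<^sub>m (r i)) B | B. B \<in> upper_families k r UNIV}"

definition inv_mat :: "'a::comm_ring_1 mat \<Rightarrow> 'a mat" where
  "inv_mat F = (THE G. inverts_mat F G \<and> inverts_mat G F)"

definition gauge_transform :: "complex \<Rightarrow> germ mat \<Rightarrow> germ mat \<Rightarrow> germ mat" where
  "gauge_transform q F A = map_mat (sigma q) F * A * inv_mat F"

definition A_mat :: "nat \<Rightarrow> (nat \<Rightarrow> nat) \<Rightarrow> (nat \<Rightarrow> int) \<Rightarrow> (nat \<Rightarrow> complex mat) \<Rightarrow>
    (nat \<Rightarrow> nat \<Rightarrow> germ mat) \<Rightarrow> germ mat" where
  "A_mat k r \<mu> A U =
     upper_block_mat k r (\<lambda>i. z_powi_germ (- \<mu> i) \<cdot>\<^sub>m map_mat const_germ (A i)) U"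


section \<open>Basic properties\<close>

lemma block_start_mono: "i \<le> j \<Longrightarrow> block_start r i \<le> block_start r j"
  unfolding block_start_def by (intro sum_mono2) auto

lemma block_of_eq:
  assumes "a < r i"
  shows "block_of r (block_start r i + a) = i"
  unfolding block_of_def
proof (rule Least_equality)
  show "block_start r i + a < block_start r (Suc i)"
    using assms by (simp add: block_start_def)
  fix y assume y: "block_start r i + a < block_start r (Suc y)"
  show "i \<le> y"
  proof (rule ccontr)
    assume "\<not> i \<le> y"
    hence "block_start r (Suc y) \<le> block_start r i" by (intro block_start_mono) auto
    with y show False by simp
  qed
qed

lemma block_position:
  assumes "p < (\<Sum>i<k. r i)"
  obtains i a where "i < k" "a < r i" "p = block_start r i + a"
proof -
  have "\<exists>i a. i < k \<and> a < r i \<and> p = block_start r i + a"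
    using assms
  proof (induction k)
    case (Suc k)
    show ?case
    proof (cases "p < (\<Sum>i<k. r i)")
      case True
      with Suc.IH show ?thesis using less_SucI by blast
    next
      case False
      with Suc.prems show ?thesis
        by (intro exI[of _ k] exI[of _ "p - (\<Sum>i<k. r i)"]) (auto simp: block_start_def)
    qed
  qed simp
  thus thesis using that by blast
qed

lemma block_start_add_less:
  assumes "i < k" "a < r i"
  shows "block_start r i + a < (\<Sum>i<k. r i)"
proof -
  have "block_start r i + a < block_start r (Suc i)"
    using assms by (simp add: block_start_def)
  also have "\<dots> \<le> block_start r k" using assms by (intro block_start_mono) auto
  finally show ?thesis by (simp add: block_start_def)
qed

lemma index_block_mat:
  assumes "i < k" "j < k" "a < r i" "b < r j"
  shows "block_mat k r B $$ (block_start r i + a, block_start r j + b) = B i j $$ (a, b)"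
  using assms by (simp add: block_mat_def block_of_eq block_start_add_less)

lemma inv_mat_eq:
  fixes F :: "'a::comm_ring_1 mat"
  assumes F: "F \<in> carrier_mat n n" and G: "G \<in> carrier_mat n n"
    and FG: "F * G = 1\<^sub>m n" and GF: "G * F = 1\<^sub>m n"
  shows "inv_mat F = G"
  unfolding inv_mat_def
proof (rule the_equality)
  show "inverts_mat F G \<and> inverts_mat G F"
    using assms by (auto simp: inverts_mat_def)
  fix H assume "inverts_mat F H \<and> inverts_mat H F"
  hence 1: "F * H = 1\<^sub>m n" and 2: "H * F = 1\<^sub>m (dim_row H)"
    using F by (auto simp: inverts_mat_def)
  have "dim_col H = n" using arg_cong[OF 1, of dim_col] by simp
  moreover have "dim_row H = n" using arg_cong[OF 2, of dim_col] F by simp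
  ultimately have H: "H \<in> carrier_mat n n" by auto
  have "H = (G * F) * H" using GF H by simp
  also have "\<dots> = G * (F * H)" by (rule assoc_mult_mat[OF G F H])
  finally show "H = G" using 1 G by simp
qed

lemma unipotent_group_carrier:
  "F \<in> unipotent_group k r \<Longrightarrow> F \<in> carrier_mat (\<Sum>i<k. r i) (\<Sum>i<k. r i)"
  by (auto simp: unipotent_group_def upper_block_mat_def block_mat_def)

lemma det_unipotent_group:
  assumes "F \<in> unipotent_group k r"
  shows "det F = (1 :: 'a::comm_ring_1)"
proof -
  let ?n = "\<Sum>i<k. r i"
  from assms obtain B where
    F: "F = upper_block_mat k r (\<lambda>i. 1\<^sub>m (r i)) B" by (auto simp: unipotent_group_def)
  have car: "F \<in> carrier_mat ?n ?n" using assms by (rule unipotent_group_carrier)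
  have low: "F $$ (p, s) = (if p = s then 1 else 0)" if "p < ?n" "s \<le> p" for p s
  proof -
    from that obtain i a where i: "i < k" "a < r i" "p = block_start r i + a"
      by (elim block_position)
    from that have "s < ?n" by simp
    then obtain j b where j: "j < k" "b < r j" "s = block_start r j + b"
      by (elim block_position)
    have "j \<le> i"
    proof (rule ccontr)
      assume "\<not> j \<le> i"
      hence "block_start r (Suc i) \<le> block_start r j" by (intro block_start_mono) auto
      with i j that show False by (simp add: block_start_def)
    qed
    moreover have "p \<noteq> s" if "j < i"
      using that i j block_of_eq[of a r i] block_of_eq[of b r j] by auto
    ultimately show ?thesis
      using i j by (auto simp: F upper_block_mat_def index_block_mat)
  qed
  have ut: "upper_triangular F"
    unfolding upper_triangular_def using car low by auto
  have "diag_mat F = map (\<lambda>_. 1) [0..<?n]"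
    using car low by (auto simp: diag_mat_def)
  hence "prod_list (diag_mat F) = 1"
    by (simp add: map_replicate_const)
  with det_upper_triangular[OF ut car] show ?thesis by simp
qed

text \<open>The inverse occurring in the gauge action is a genuine one.\<close>

lemma unipotent_group_inverse:
  fixes F :: "'a::comm_ring_1 mat"
  assumes "F \<in> unipotent_group k r"
  defines "n \<equiv> \<Sum>i<k. r i"
  shows "inv_mat F \<in> carrier_mat n n" "F * inv_mat F = 1\<^sub>m n" "inv_mat F * F = 1\<^sub>m n"
proof -
  have car: "F \<in> carrier_mat n n"
    using unipotent_group_carrier[OF assms(1)] by (simp add: n_def)
  have inv: "inv_mat F = adj_mat F"
    using adj_mat[OF car] det_unipotent_group[OF assms(1)]
    by (intro inv_mat_eq[OF car]) auto
  show "inv_mat F \<in> carrier_mat n n" "F * inv_mat F = 1\<^sub>m n" "inv_mat F * F = 1\<^sub>m n"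
    using adj_mat[OF car] det_unipotent_group[OF assms(1)] by (auto simp: inv)
qed

end

theory Submission
  imports Defs
begin

text \<open>
  Write \<open>F[A\<^sub>U] = A\<^sub>V\<close> as \<open>\<sigma>\<^sub>q F A\<^sub>U = A\<^sub>V F\<close>. The diagonal blocks agree, and block \<open>(i, j)\<close> with
  \<open>i < j\<close> is an equation
  \[ (\sigma_q F_{ij}) z^{-\mu_j} A_j + W_{ij} = V_{ij} + z^{-\mu_i} A_i F_{ij}, \]
  where \<open>W\<^sub>i\<^sub>j\<close> involves \<open>U\<close> and those blocks of \<open>F\<close> and \<open>V\<close> that lie closer to the diagonal.
  So it suffices to solve each of these equations with \<open>W\<^sub>i\<^sub>j\<close> given, in increasing order of
  \<open>j - i\<close> (\<open>block_triangular_recursion\<close>).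

  After multiplication by \<open>z\<^sup>\<mu>\<^sup>i A\<^sub>i\<^sup>-\<^sup>1\<close> the equation says that
  \<open>F\<^sub>i\<^sub>j - z\<^sup>d A\<^sub>i\<^sup>-\<^sup>1 (\<sigma>\<^sub>q F\<^sub>i\<^sub>j) A\<^sub>j\<close>, with \<open>d = \<mu>\<^sub>i - \<mu>\<^sub>j > 0\<close>, equals a given germ up to an error in
  the field of convergent fractions. A germ is the sum of a germ that is holomorphic at \<open>0\<close>, which can be moved
  into the error, and of \<open>G(1/z)\<close> with \<open>G\<close> entire (\<open>Laurent_splitting\<close>). Look for
  \<open>F\<^sub>i\<^sub>j = \<Sum> f\<^sub>m z\<^sup>-\<^sup>m\<close>. Up to a polynomial in \<open>z\<close>, which is again an error, multiplication by
  \<open>z\<^sup>d\<close> shifts the coefficient sequence by \<open>d\<close>, and the equation becomes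
  \[ f_m = g_m + q^{-(m + d)} A_i^{-1} f_{m + d} A_j \quad (m \ge 0). \]
  It expresses \<open>f\<^sub>m\<close> by later coefficients. Solving it by iteration gives a series whose
  \<open>p\<close>-th term is at most \<open>K\<^sup>p \<bar>g\<^sub>m\<^sub>+\<^sub>p\<^sub>d\<bar>\<close> with a constant \<open>K\<close>. As \<open>G\<close> is entire, \<open>g\<close> decays faster than every geometric
  sequence, hence the series converges and its sum decays equally fast
  (\<open>entire_fixpoint_exists\<close>). This uses \<open>d > 0\<close>, so that the recursion looks ahead, and
  \<open>\<bar>q\<bar> \<ge> 1\<close>, so that the powers of \<open>q\<close> do no harm.
\<close>

section \<open>Splitting a germ into a holomorphic and a principal part\<close>

lemma integrals_over_concentric_circles_eq:
  assumes holf: "f holomorphic_on ball 0 R - {0}" and "0 < s" "s \<le> r" "r < R"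
  shows "f contour_integrable_on circlepath 0 s"
    "contour_integral (circlepath 0 r) f = contour_integral (circlepath 0 s) f"
proof -
  have "cball 0 r \<subseteq> ball (0::complex) R" using assms by auto
  thus "f contour_integrable_on circlepath 0 s"
    "contour_integral (circlepath 0 r) f = contour_integral (circlepath 0 s) f"
    using contour_integral_circlepath_eq[of "ball 0 R" f 0 s r] assms by auto
qed

lemma bounded_on_circle_around_puncture:
  fixes f :: "complex \<Rightarrow> complex"
  assumes holf: "f holomorphic_on ball 0 R - {0}" and s: "0 < s" "s < R"
  obtains B where "B \<ge> 0" "\<And>w. norm w = s \<Longrightarrow> norm (f w) \<le> B"
proof -
  have "continuous_on (sphere 0 s) f"
    by (rule holomorphic_on_imp_continuous_on, rule holomorphic_on_subset[OF holf]) (use s in auto)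
  hence "bounded (f ` sphere 0 s)" by (intro compact_imp_bounded compact_continuous_image) auto
  then obtain B where "B > 0" "\<forall>x\<in>f ` sphere 0 s. norm x \<le> B"
    by (auto simp: bounded_pos)
  thus ?thesis by (intro that[of B]) auto
qed

text \<open>
  The difference quotient \<open>(f w - f z) / (w - z)\<close> extends holomorphically to \<open>w = z\<close>, so its
  integrals over the two circles agree. The integral of the remaining \<open>f z / (w - z)\<close> is known on
  each circle, because only the outer one encloses \<open>z\<close>.
\<close>

lemma Cauchy_integral_formula_annulus:
  assumes holf: "f holomorphic_on ball 0 R - {0}"
    and s: "0 < s" "s < norm z" and r: "norm z < r" "r < R"
  shows "contour_integral (circlepath 0 r) (\<lambda>w. f w / (w - z)) =
           contour_integral (circlepath 0 s) (\<lambda>w. f w / (w - z)) + 2 * of_real pi * \<i> * f z"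
proof -
  define \<phi> where "\<phi> = (\<lambda>w. if w = z then deriv f z else (f w - f z) / (w - z))"
  have hol\<phi>: "\<phi> holomorphic_on ball 0 R - {0}"
    unfolding \<phi>_def by (rule pole_lemma_open[OF holf]) auto
  have split: "((\<lambda>w. f w / (w - z)) has_contour_integral
        contour_integral (circlepath 0 t) \<phi> + c) (circlepath 0 t)"
    if t: "0 < t" "t < R" "norm z \<noteq> t"
      and c: "((\<lambda>w. f z / (w - z)) has_contour_integral c) (circlepath 0 t)" for t c
  proof -
    have "(\<phi> has_contour_integral contour_integral (circlepath 0 t) \<phi>) (circlepath 0 t)"
      using integrals_over_concentric_circles_eq(1)[OF hol\<phi>, of t t] t
      by (simp add: has_contour_integral_integral)
    from has_contour_integral_add[OF this c] show ?thesis
      by (rule has_contour_integral_eq) (use t in \<open>auto simp: \<phi>_def diff_divide_distrib\<close>)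
  qed
  have out: "((\<lambda>w. f z / (w - z)) has_contour_integral 2 * of_real pi * \<i> * f z) (circlepath 0 r)"
    using Cauchy_integral_circlepath_simple[of "\<lambda>_. f z" 0 r z] r by simp
  have "(\<lambda>w. f z / (w - z)) holomorphic_on ball 0 (norm z)"
    by (intro holomorphic_intros) auto
  hence inn: "((\<lambda>w. f z / (w - z)) has_contour_integral 0) (circlepath 0 s)"
    using s by (intro Cauchy_theorem_disc_simple) auto
  have "contour_integral (circlepath 0 r) \<phi> = contour_integral (circlepath 0 s) \<phi>"
    using s r by (intro integrals_over_concentric_circles_eq[OF hol\<phi>]) auto
  thus ?thesis
    using split[OF _ _ _ out] split[OF _ _ _ inn] s r
    by (simp add: contour_integral_unique)
qed

text \<open>
  For \<open>\<bar>w\<bar> = s < \<bar>z\<bar>\<close> expand \<open>-1 / (w - z)\<close> as the geometric series \<open>\<Sum> w\<^sup>m / z\<^sup>m\<^sup>+\<^sup>1\<close> and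
  integrate term by term; the remainder after \<open>N\<close> terms is of the order of \<open>(s / \<bar>z\<bar>)\<^sup>N\<close>.
\<close>

lemma Cauchy_integral_outside_sums:
  assumes holf: "f holomorphic_on ball 0 R - {0}"
    and s: "0 < s" "s < R" "s < norm z"
  shows "(\<lambda>m. contour_integral (circlepath 0 s) (\<lambda>w. f w * w ^ m) * inverse z ^ Suc m) sums
           (- contour_integral (circlepath 0 s) (\<lambda>w. f w / (w - z)))"
proof -
  have z: "z \<noteq> 0" using s by auto
  obtain B where B0: "B \<ge> 0" and B: "\<And>w. norm w = s \<Longrightarrow> norm (f w) \<le> B"
    using bounded_on_circle_around_puncture[OF holf s(1,2)] by metis
  have int: "(\<lambda>w. f w * w ^ m) contour_integrable_on circlepath 0 s" for m
    by (rule integrals_over_concentric_circles_eq[of _ R]) (use s holf in \<open>auto intro!: holomorphic_intros\<close>)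
  have holz: "(\<lambda>w. f w / (w - z)) holomorphic_on ball 0 (min R (norm z)) - {0}"
    using holf by (intro holomorphic_intros holomorphic_on_subset[OF holf]) auto
  have intz: "(\<lambda>w. f w / (w - z)) contour_integrable_on circlepath 0 s"
    by (rule integrals_over_concentric_circles_eq[OF holz]) (use s in auto)
  define S where "S = (\<lambda>N. \<Sum>m<N. contour_integral (circlepath 0 s) (\<lambda>w. f w * w ^ m) * inverse z ^ Suc m)"
  have bound: "norm (S N - (- contour_integral (circlepath 0 s) (\<lambda>w. f w / (w - z))))
      \<le> B / (norm z - s) * (2 * pi * s) * (s / norm z) ^ N" for N
  proof -
    have 1: "((\<lambda>w. \<Sum>m<N. f w * w ^ m * inverse z ^ Suc m) has_contour_integral S N) (circlepath 0 s)"
      unfolding S_def by (intro has_contour_integral_sum has_contour_integral_rmul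
          has_contour_integral_integral int) auto
    have 2: "((\<lambda>w. (\<Sum>m<N. f w * w ^ m * inverse z ^ Suc m) + f w / (w - z)) has_contour_integral
         S N + contour_integral (circlepath 0 s) (\<lambda>w. f w / (w - z))) (circlepath 0 s)"
      by (intro has_contour_integral_add 1 has_contour_integral_integral intz)
    have tail: "(\<Sum>m<N. f w * w ^ m * inverse z ^ Suc m) + f w / (w - z) = f w * (w / z) ^ N / (w - z)"
      if "norm w = s" for w
    proof -
      have wz: "w - z \<noteq> 0" using that s by auto
      have ne: "w / z \<noteq> 1" using that s z by auto
      have "(\<Sum>m<N. f w * w ^ m * inverse z ^ Suc m) = f w / z * (\<Sum>m<N. (w / z) ^ m)"
        by (simp add: sum_distrib_left field_simps)
      also have "\<dots> = f w * ((w / z) ^ N - 1) / (z * (w / z - 1))"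
        by (simp add: geometric_sum[OF ne])
      also have "z * (w / z - 1) = w - z"
        using z by (simp add: field_simps)
      finally show ?thesis by (simp add: field_simps diff_divide_distrib)
    qed
    have "norm (S N + contour_integral (circlepath 0 s) (\<lambda>w. f w / (w - z)))
       \<le> B * (s / norm z) ^ N / (norm z - s) * (2 * pi * s)"
    proof (rule has_contour_integral_bound_circlepath[OF 2])
      fix w :: complex assume "norm (w - 0) = s"
      hence w: "norm w = s" by simp
      have "norm z - s \<le> norm (w - z)"
        using norm_triangle_ineq2[of z w] w by (simp add: norm_minus_commute)
      thus "norm ((\<Sum>m<N. f w * w ^ m * inverse z ^ Suc m) + f w / (w - z))
          \<le> B * (s / norm z) ^ N / (norm z - s)"
        unfolding tail[OF w] norm_divide norm_mult norm_power w
        by (intro frac_le mult_mono B w) (use s B0 in auto)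
    qed (use s B0 in auto)
    thus ?thesis by (simp add: mult_ac)
  qed
  have "(\<lambda>N. B / (norm z - s) * (2 * pi * s) * (s / norm z) ^ N) \<longlonglongrightarrow>
          B / (norm z - s) * (2 * pi * s) * 0"
    by (intro tendsto_intros LIMSEQ_power_zero) (use s in \<open>auto simp: divide_less_eq\<close>)
  hence "(\<lambda>N. B / (norm z - s) * (2 * pi * s) * (s / norm z) ^ N) \<longlonglongrightarrow> 0" by simp
  hence "(\<lambda>N. S N - (- contour_integral (circlepath 0 s) (\<lambda>w. f w / (w - z)))) \<longlonglongrightarrow> 0"
    using bound by (rule Lim_null_comparison[rotated, OF _ always_eventually, OF _ allI])
  hence "S \<longlonglongrightarrow> - contour_integral (circlepath 0 s) (\<lambda>w. f w / (w - z))"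
    by (rule LIM_zero_cancel)
  thus ?thesis by (simp add: S_def sums_def)
qed

lemma fps_conv_radius_infinityI:
  fixes F :: "complex fps"
  assumes "\<And>x. x > 0 \<Longrightarrow> \<exists>C. \<forall>m. norm (fps_nth F m) \<le> C / x ^ m"
  shows "fps_conv_radius F = \<infinity>"
proof -
  have "conv_radius (fps_nth F) \<ge> \<infinity>"
  proof (rule conv_radius_geI_ex')
    fix x :: real assume x: "x > 0"
    from assms[of "2 * x"] x obtain C where C: "\<And>m. norm (fps_nth F m) \<le> C / (2 * x) ^ m" by auto
    have "C \<ge> 0" using order_trans[OF norm_ge_zero C[of 0]] by simp
    show "summable (\<lambda>m. fps_nth F m * of_real x ^ m)"
    proof (rule summable_comparison_test')
      show "summable (\<lambda>m. C * (1 / 2) ^ m)" by (intro summable_mult summable_geometric) auto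
      fix m
      have "norm (fps_nth F m * of_real x ^ m) \<le> C / (2 * x) ^ m * x ^ m"
        unfolding norm_mult norm_power using x \<open>C \<ge> 0\<close> by (intro mult_mono C) auto
      also have "\<dots> = C * (1 / 2) ^ m" using x by (simp add: field_simps)
      finally show "norm (fps_nth F m * of_real x ^ m) \<le> C * (1 / 2) ^ m" .
    qed
  qed
  thus ?thesis by (simp add: fps_conv_radius_def)
qed

lemma fps_conv_radius_infinityD:
  fixes F :: "complex fps"
  assumes "fps_conv_radius F = \<infinity>" "x > 0"
  obtains C where "\<And>m. norm (fps_nth F m) \<le> C / x ^ m" "C \<ge> 0"
proof -
  have "summable (\<lambda>m. fps_nth F m * of_real x ^ m)" by (rule summable_fps) (simp add: assms)
  hence "(\<lambda>m. fps_nth F m * of_real x ^ m) \<longlonglongrightarrow> 0" by (rule summable_LIMSEQ_zero)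
  hence "Bseq (\<lambda>m. fps_nth F m * of_real x ^ m)" by (rule convergent_imp_Bseq[OF convergentI])
  then obtain C where "C > 0" and C: "\<And>m. norm (fps_nth F m * of_real x ^ m) \<le> C"
    by (auto simp: Bseq_def)
  have "norm (fps_nth F m) \<le> C / x ^ m" for m
    using C[of m] \<open>x > 0\<close> by (simp add: norm_mult norm_power field_simps)
  with \<open>C > 0\<close> show ?thesis by (intro that[of C]) auto
qed

text \<open>
  By Cauchy's formula on an annulus, \<open>f z\<close> is a Cauchy integral \<open>h z\<close> over a fixed circle of radius
  \<open>r\<close>, which is holomorphic inside, minus a Cauchy integral over a small circle, which is a power
  series in \<open>1/z\<close>. The coefficients of the latter do not depend on the small radius \<open>s\<close>, and
  letting \<open>s\<close> tend to \<open>0\<close> shows that they decay faster than every geometric sequence.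
\<close>

lemma Laurent_splitting:
  assumes "isolated_singularity_at f 0"
  obtains h G where "h analytic_on {0}" "fps_conv_radius G = \<infinity>"
    "\<forall>\<^sub>F z in at 0. f z = h z + eval_fps G (inverse z)"
proof -
  from assms obtain R where R: "R > 0" and "f analytic_on ball 0 R - {0}"
    by (auto simp: isolated_singularity_at_def)
  hence holf: "f holomorphic_on ball 0 R - {0}" by (simp add: analytic_imp_holomorphic)
  define r where "r = R / 2"
  have r: "0 < r" "r < R" using R by (auto simp: r_def)
  define c :: complex where "c = 1 / (2 * of_real pi * \<i>)"
  define h where "h = (\<lambda>z. c * contour_integral (circlepath 0 r) (\<lambda>w. f w / (w - z)))"
  define g where "g = (\<lambda>m. c * contour_integral (circlepath 0 r) (\<lambda>w. f w * w ^ m))"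
  \<comment> \<open>The factor \<open>fps_X\<close> accounts for the exponents \<open>- m - 1\<close> of \<open>z\<close>.\<close>
  define G where "G = fps_X * Abs_fps g"
  have contf: "continuous_on (sphere 0 s) f" if "0 < s" "s < R" for s
    by (rule holomorphic_on_imp_continuous_on, rule holomorphic_on_subset[OF holf]) (use that in auto)
  have holm: "(\<lambda>w. f w * w ^ m) holomorphic_on ball 0 R - {0}" for m
    by (intro holomorphic_intros holf)
  have g_eq: "g m = c * contour_integral (circlepath 0 s) (\<lambda>w. f w * w ^ m)" if "0 < s" "s \<le> r" for s m
    unfolding g_def using integrals_over_concentric_circles_eq[OF holm[of m], of s r] that r by simp

  have "h holomorphic_on ball 0 r"
  proof -
    have int: "((\<lambda>w. f w / (w - z) ^ 1) has_contour_integral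
        contour_integral (circlepath 0 r) (\<lambda>w. f w / (w - z))) (circlepath 0 r)" if "z \<in> ball 0 r" for z
      using that r contf[of r] unfolding power_one_right
      by (intro has_contour_integral_integral contour_integrable_continuous_circlepath continuous_intros) auto
    have "(\<lambda>z. contour_integral (circlepath 0 r) (\<lambda>w. f w / (w - z))) holomorphic_on ball 0 r"
      unfolding holomorphic_on_open[OF open_ball]
      using Cauchy_next_derivative_circlepath(2)[OF _ int] contf[of r] r by fastforce
    thus ?thesis unfolding h_def by (intro holomorphic_intros)
  qed
  hence "h analytic_on {0}" using r unfolding analytic_at by (intro exI[of _ "ball 0 r"]) auto

  moreover have g_bound: "\<exists>C. \<forall>m. norm (fps_nth (Abs_fps g) m) \<le> C / x ^ m" if x: "x > 0" for x
  proof -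
    \<comment> \<open>Over the circle of radius at most \<open>1 / x\<close> the integrand of \<open>g m\<close> is \<open>O(x\<^sup>-\<^sup>m)\<close>.\<close>
    define s where "s = min r (1 / x)"
    have s: "0 < s" "s \<le> r" "s \<le> 1 / x" using r x by (auto simp: s_def)
    obtain B where B0: "B \<ge> 0" and B: "\<And>w. norm w = s \<Longrightarrow> norm (f w) \<le> B"
      using bounded_on_circle_around_puncture[OF holf \<open>0 < s\<close>] s r by (metis le_less_trans)
    have "norm (g m) \<le> (norm c * B * (2 * pi * s)) / x ^ m" for m
    proof -
      have "norm (contour_integral (circlepath 0 s) (\<lambda>w. f w * w ^ m)) \<le> (B * s ^ m) * (2 * pi * s)"
      proof (rule has_contour_integral_bound_circlepath)
        show "((\<lambda>w. f w * w ^ m) has_contour_integral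
            contour_integral (circlepath 0 s) (\<lambda>w. f w * w ^ m)) (circlepath 0 s)"
          using integrals_over_concentric_circles_eq(1)[OF holm[of m], of s s] s r
          by (simp add: has_contour_integral_integral)
      qed (use s B B0 in \<open>auto simp: norm_mult norm_power intro!: mult_right_mono\<close>)
      hence "norm (g m) \<le> norm c * ((B * s ^ m) * (2 * pi * s))"
        unfolding g_eq[OF s(1,2)] norm_mult by (intro mult_left_mono) auto
      also have "\<dots> = (norm c * B * (2 * pi * s)) * s ^ m" by (simp add: mult_ac)
      also have "\<dots> \<le> (norm c * B * (2 * pi * s)) * (1 / x) ^ m"
        using s B0 by (intro mult_left_mono power_mono) auto
      finally show ?thesis by (simp add: power_divide)
    qed
    thus ?thesis by auto
  qed
  have conv_g: "fps_conv_radius (Abs_fps g) = \<infinity>" by (rule fps_conv_radius_infinityI[OF g_bound])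
  have "fps_conv_radius G = \<infinity>"
    using fps_conv_radius_mult[of fps_X "Abs_fps g"] conv_g by (simp add: G_def)

  moreover have "f z = h z + eval_fps G (inverse z)" if z: "norm z < r" "z \<noteq> 0" for z
  proof -
    define s where "s = norm z / 2"
    have s: "0 < s" "s < norm z" "s \<le> r" using z r by (auto simp: s_def)
    have "(\<lambda>m. c * (contour_integral (circlepath 0 s) (\<lambda>w. f w * w ^ m) * inverse z ^ Suc m)) sums
             (c * - contour_integral (circlepath 0 s) (\<lambda>w. f w / (w - z)))"
      by (intro sums_mult Cauchy_integral_outside_sums[OF holf]) (use s r in auto)
    moreover have "eval_fps G (inverse z) = inverse z * (\<Sum>m. g m * inverse z ^ m)"
      by (simp add: G_def eval_fps_mult conv_g eval_fps_def[of "Abs_fps g"])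
    moreover have "\<dots> = (\<Sum>m. inverse z * (g m * inverse z ^ m))"
      using summable_fps[of "inverse z" "Abs_fps g"] conv_g by (subst suminf_mult) auto
    ultimately have "eval_fps G (inverse z) = - c * contour_integral (circlepath 0 s) (\<lambda>w. f w / (w - z))"
      using s by (simp add: g_eq[of s] sums_iff mult_ac)
    thus ?thesis
      using Cauchy_integral_formula_annulus[OF holf s(1,2) z(1) r(2)]
      by (simp add: h_def c_def field_simps)
  qed
  hence "\<forall>\<^sub>F z in at 0. f z = h z + eval_fps G (inverse z)"
    unfolding eventually_at using r by (intro exI[of _ r]) auto
  ultimately show ?thesis by (intro that)
qed

section \<open>The recursion for the principal parts\<close>

text \<open>
  The solution is the sum of the iterates \<open>v p\<close> of the linear operator on the right, started at
  \<open>G\<close>. Each iteration costs a factor \<open>K\<close>, an upper bound for the row sums of \<open>M\<close>, but looks at coefficients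
  whose index is larger by \<open>d\<close>. If \<open>\<bar>g\<^sub>m\<bar> \<le> C / x\<^sup>m\<close>, then a step gains \<open>x\<^sup>-\<^sup>d\<close>. Because
  \<open>G\<close> is entire, \<open>x\<close> can be taken as large as desired: first so large that
  the iterates decrease geometrically, and then beyond any prescribed radius, which makes the solution entire.
\<close>

lemma entire_fixpoint_exists:
  fixes M :: "'i \<Rightarrow> 'i \<Rightarrow> complex" and G :: "'i \<Rightarrow> complex fps"
  assumes I: "finite I" and d: "d > 0" and q: "norm q \<ge> 1"
    and G: "\<And>s. s \<in> I \<Longrightarrow> fps_conv_radius (G s) = \<infinity>"
  obtains F where "\<And>s. s \<in> I \<Longrightarrow> fps_conv_radius (F s) = \<infinity>"
    and "\<And>s m. s \<in> I \<Longrightarrow> fps_nth (F s) m =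
           fps_nth (G s) m + (\<Sum>t\<in>I. M s t * (inverse q ^ (m + d) * fps_nth (F t) (m + d)))"
proof -
  define v :: "nat \<Rightarrow> 'i \<Rightarrow> nat \<Rightarrow> complex" where
    "v = rec_nat (\<lambda>s. fps_nth (G s)) (\<lambda>_ u s m. \<Sum>t\<in>I. M s t * (inverse q ^ (m + d) * u t (m + d)))"
  have v0: "v 0 s m = fps_nth (G s) m" for s m by (simp add: v_def)
  have vSuc: "v (Suc p) s m = (\<Sum>t\<in>I. M s t * (inverse q ^ (m + d) * v p t (m + d)))" for p s m
    by (simp add: v_def)
  define K where "K = (\<Sum>s\<in>I. \<Sum>t\<in>I. norm (M s t))"
  have K0: "K \<ge> 0" unfolding K_def by (intro sum_nonneg norm_ge_zero)
  have K: "(\<Sum>t\<in>I. norm (M s t)) \<le> K" if "s \<in> I" for s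
    unfolding K_def by (rule member_le_sum) (use that I in \<open>auto intro: sum_nonneg\<close>)
  have bound: "\<exists>C x. x \<ge> y \<and> C \<ge> 0 \<and> (\<forall>p. \<forall>s\<in>I. \<forall>m. norm (v p s m) \<le> C / x ^ m * (1 / 2) ^ p)"
    if y: "y > 0" for y
  proof -
    \<comment> \<open>Then \<open>K / x\<^sup>d \<le> 1/2\<close>, so that each iteration at least halves the bound.\<close>
    define x where "x = max y (2 * K + 1)"
    have x: "x \<ge> y" "x > 0" "x \<ge> 1" "2 * K \<le> x" using y K0 by (auto simp: x_def)
    have xd: "2 * K \<le> x ^ d" using self_le_power[of x d] x d by simp
    have "\<forall>s\<in>I. \<exists>C\<ge>0. \<forall>m. norm (fps_nth (G s) m) \<le> C / x ^ m"
      using fps_conv_radius_infinityD[OF G \<open>x > 0\<close>] by metis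
    then obtain C where C: "\<And>s. s \<in> I \<Longrightarrow> C s \<ge> 0" "\<And>s m. s \<in> I \<Longrightarrow> norm (fps_nth (G s) m) \<le> C s / x ^ m"
      by metis
    have C': "norm (fps_nth (G s) m) \<le> sum C I / x ^ m" if "s \<in> I" for s m
    proof -
      have "C s \<le> sum C I" by (rule member_le_sum) (use C I that in auto)
      hence "C s / x ^ m \<le> sum C I / x ^ m" using x by (intro divide_right_mono) auto
      thus ?thesis using C(2)[OF that, of m] by simp
    qed
    have S0: "sum C I \<ge> 0" by (intro sum_nonneg C)
    have "norm (v p s m) \<le> sum C I / x ^ m * (1 / 2) ^ p" if "s \<in> I" for p s m
      using that
    proof (induction p arbitrary: s m)
      case 0
      thus ?case by (simp add: v0 C')
    next
      case (Suc p)
      define b where "b = sum C I / x ^ (m + d) * (1 / 2) ^ p"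
      have b0: "b \<ge> 0" using S0 x by (auto simp: b_def)
      have "norm (v (Suc p) s m) \<le> (\<Sum>t\<in>I. norm (M s t) * (1 * b))"
        unfolding vSuc
      proof (intro sum_norm_le, unfold norm_mult)
        fix t assume "t \<in> I"
        have "norm (inverse q ^ (m + d)) \<le> 1"
          unfolding norm_power norm_inverse using le_imp_inverse_le[OF q]
          by (intro power_le_one) auto
        moreover have "norm (v p t (m + d)) \<le> b" unfolding b_def by (rule Suc.IH) fact
        ultimately show "norm (M s t) * (norm (inverse q ^ (m + d)) * norm (v p t (m + d)))
            \<le> norm (M s t) * (1 * b)"
          by (intro mult_left_mono mult_mono) auto
      qed
      also have "\<dots> \<le> K * b"
        unfolding mult_1 sum_distrib_right[symmetric] using b0 K[OF Suc.prems] by (intro mult_right_mono)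
      also have "\<dots> \<le> x ^ d / 2 * b"
        using xd b0 by (intro mult_right_mono) auto
      also have "\<dots> = sum C I / x ^ m * (1 / 2) ^ Suc p"
        using x by (simp add: b_def power_add)
      finally show ?case .
    qed
    with S0 x(1) show ?thesis by blast
  qed
  have summ: "summable (\<lambda>p. v p s m)" if "s \<in> I" for s m
  proof -
    have "(1::real) > 0" by simp
    from bound[OF this] obtain C x where C: "norm (v p s m) \<le> C / x ^ m * (1 / 2) ^ p" for p
      using \<open>s \<in> I\<close> by blast
    have "summable (\<lambda>p. C / x ^ m * (1 / 2) ^ p)" by (intro summable_mult summable_geometric) auto
    thus ?thesis by (rule summable_comparison_test'[where N = 0]) (rule C)
  qed
  define F where "F = (\<lambda>s. Abs_fps (\<lambda>m. \<Sum>p. v p s m))"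
  have "fps_conv_radius (F s) = \<infinity>" if s: "s \<in> I" for s
  proof (rule fps_conv_radius_infinityI)
    fix y :: real assume y: "y > 0"
    then obtain C x where C: "x \<ge> y" "C \<ge> 0" "\<And>p m. norm (v p s m) \<le> C / x ^ m * (1 / 2) ^ p"
      using bound[of y] s by blast
    have "norm (fps_nth (F s) m) \<le> (2 * C) / y ^ m" for m
    proof -
      have sums: "(\<lambda>p. C / x ^ m * (1 / 2) ^ p) sums (C / x ^ m * 2)"
        using geometric_sums[of "1 / 2 :: real"] by (intro sums_mult) auto
      have "norm (fps_nth (F s) m) \<le> C / x ^ m * 2"
        unfolding F_def fps_nth_Abs_fps sums_unique[OF sums]
        by (rule norm_suminf_le[OF C(3) sums_summable[OF sums]])
      also have "\<dots> \<le> C / y ^ m * 2"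
        using C y by (intro mult_right_mono divide_left_mono power_mono mult_pos_pos zero_less_power) auto
      finally show ?thesis by (simp add: mult_ac)
    qed
    thus "\<exists>C. \<forall>m. norm (fps_nth (F s) m) \<le> C / y ^ m" by blast
  qed
  moreover have "fps_nth (F s) m =
      fps_nth (G s) m + (\<Sum>t\<in>I. M s t * (inverse q ^ (m + d) * fps_nth (F t) (m + d)))"
    if s: "s \<in> I" for s m
  proof -
    have "fps_nth (F s) m = v 0 s m + (\<Sum>p. v (Suc p) s m)"
      unfolding F_def fps_nth_Abs_fps using suminf_split_head[OF summ[OF s, of m]] by simp
    also have "(\<Sum>p. v (Suc p) s m) = (\<Sum>t\<in>I. \<Sum>p. M s t * (inverse q ^ (m + d) * v p t (m + d)))"
      unfolding vSuc by (intro suminf_sum summable_mult summ)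
    also have "\<dots> = (\<Sum>t\<in>I. M s t * (inverse q ^ (m + d) * fps_nth (F t) (m + d)))"
      using summ by (intro sum.cong refl) (simp add: F_def suminf_mult summable_mult)
    finally show ?thesis by (simp add: v0)
  qed
  ultimately show ?thesis by (rule that)
qed

text \<open>
  On series in \<open>1/z\<close>, multiplication by \<open>z\<^sup>d\<close> is the shift by \<open>d\<close>, up to the finitely many
  terms that acquire positive powers of \<open>z\<close>.
\<close>

lemma power_mult_eval_fps_inverse:
  fixes H :: "complex fps"
  assumes H: "fps_conv_radius H = \<infinity>" and z: "z \<noteq> 0"
  shows "z ^ d * eval_fps H (inverse z) =
           eval_fps (fps_shift d H) (inverse z) + (\<Sum>m<d. fps_nth H m * z ^ (d - m))"
proof -
  have summ: "summable (\<lambda>m. fps_nth H m * inverse z ^ m)" by (rule summable_fps) (simp add: H)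
  have summ': "summable (\<lambda>m. fps_nth (fps_shift d H) m * inverse z ^ m)"
    by (rule summable_fps) (simp add: H)
  have "eval_fps H (inverse z) =
      (\<Sum>m. fps_nth H (m + d) * inverse z ^ (m + d)) + (\<Sum>m<d. fps_nth H m * inverse z ^ m)"
    unfolding eval_fps_def by (rule suminf_split_initial_segment[OF summ])
  also have "(\<Sum>m. fps_nth H (m + d) * inverse z ^ (m + d)) =
      inverse z ^ d * eval_fps (fps_shift d H) (inverse z)"
    unfolding eval_fps_def suminf_mult[OF summ', symmetric] by (simp add: power_add mult_ac)
  finally have "z ^ d * eval_fps H (inverse z) = eval_fps (fps_shift d H) (inverse z) +
      (\<Sum>m<d. z ^ d * (fps_nth H m * inverse z ^ m))"
    using z by (simp add: distrib_left sum_distrib_left power_inverse)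
  also have "(\<Sum>m<d. z ^ d * (fps_nth H m * inverse z ^ m)) = (\<Sum>m<d. fps_nth H m * z ^ (d - m))"
    using z by (intro sum.cong refl) (simp add: power_diff divide_simps)
  finally show ?thesis .
qed

lemma eval_fps_sum:
  fixes F :: "'i \<Rightarrow> complex fps"
  assumes "finite I" "\<And>i. i \<in> I \<Longrightarrow> fps_conv_radius (F i) = \<infinity>"
  shows "fps_conv_radius (sum F I) = \<infinity> \<and> eval_fps (sum F I) z = (\<Sum>i\<in>I. eval_fps (F i) z)"
  using assms
proof (induction I rule: finite_induct)
  case (insert i I)
  thus ?case
    using fps_conv_radius_add[of "F i" "sum F I"] by (simp add: eval_fps_add)
qed simp

text \<open>
  By the splitting of the \<open>f s\<close>, only their principal parts matter, and for these the system is
  the recursion solved above; the dilation by \<open>q\<close> multiplies the coefficient of \<open>z\<^sup>-\<^sup>m\<close> by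
  \<open>q\<^sup>-\<^sup>m\<close>. The error \<open>h s\<close> collects the holomorphic parts of the \<open>f s\<close> and the polynomials cut off
  by the shift.
\<close>

lemma q_difference_system_solvable_mod_analytic:
  fixes M :: "'i \<Rightarrow> 'i \<Rightarrow> complex" and f :: "'i \<Rightarrow> complex \<Rightarrow> complex"
  assumes I: "finite I" and d: "d > 0" and q: "norm q \<ge> 1"
    and f: "\<And>s. s \<in> I \<Longrightarrow> isolated_singularity_at (f s) 0"
  obtains X h where
    "\<And>s. s \<in> I \<Longrightarrow> isolated_singularity_at (X s) 0"
    "\<And>s. s \<in> I \<Longrightarrow> h s analytic_on {0}"
    "\<And>s. s \<in> I \<Longrightarrow> \<forall>\<^sub>F z in at 0. X s z = z ^ d * (\<Sum>t\<in>I. M s t * X t (q * z)) + f s z + h s z"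
proof -
  have "\<forall>s\<in>I. \<exists>h G. h analytic_on {0} \<and> fps_conv_radius G = \<infinity> \<and>
          (\<forall>\<^sub>F z in at 0. f s z = h z + eval_fps G (inverse z))"
    using Laurent_splitting[OF f] by metis
  then obtain h0 G where h0: "\<And>s. s \<in> I \<Longrightarrow> h0 s analytic_on {0}"
    and G: "\<And>s. s \<in> I \<Longrightarrow> fps_conv_radius (G s) = \<infinity>"
    and f_eq: "\<And>s. s \<in> I \<Longrightarrow> \<forall>\<^sub>F z in at 0. f s z = h0 s z + eval_fps (G s) (inverse z)"
    by metis
  obtain F where F: "\<And>s. s \<in> I \<Longrightarrow> fps_conv_radius (F s) = \<infinity>"
    and F_eq: "\<And>s m. s \<in> I \<Longrightarrow> fps_nth (F s) m =
           fps_nth (G s) m + (\<Sum>t\<in>I. M s t * (inverse q ^ (m + d) * fps_nth (F t) (m + d)))"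
    using entire_fixpoint_exists[where M = M and G = G, OF I d q G] by blast
  define H where "H = (\<lambda>t. Abs_fps (\<lambda>m. inverse q ^ m * fps_nth (F t) m))"
  define X where "X = (\<lambda>s z. eval_fps (F s) (inverse z))"
  define h where "h = (\<lambda>s z. - h0 s z - (\<Sum>t\<in>I. M s t * (\<Sum>m<d. fps_nth (H t) m * z ^ (d - m))))"
  have H: "fps_conv_radius (H t) = \<infinity>" if "t \<in> I" for t
  proof (rule fps_conv_radius_infinityI)
    fix x :: real assume "x > 0"
    from fps_conv_radius_infinityD[OF F[OF that] this]
    obtain C where C: "\<And>m. norm (fps_nth (F t) m) \<le> C / x ^ m" by metis
    have "norm (fps_nth (H t) m) \<le> 1 * (C / x ^ m)" for m
      unfolding H_def fps_nth_Abs_fps norm_mult norm_power norm_inverse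
      using le_imp_inverse_le[OF q] by (intro mult_mono power_le_one C) auto
    thus "\<exists>C. \<forall>m. norm (fps_nth (H t) m) \<le> C / x ^ m" by auto
  qed
  have X_scale: "X t (q * z) = eval_fps (H t) (inverse z)" for t z
    by (simp add: X_def H_def eval_fps_def power_mult_distrib mult_ac)
  have sumeq: "X s z = eval_fps (G s) (inverse z) +
       (\<Sum>t\<in>I. M s t * eval_fps (fps_shift d (H t)) (inverse z))" if s: "s \<in> I" for s z
  proof -
    have "F s = G s + (\<Sum>t\<in>I. fps_const (M s t) * fps_shift d (H t))"
      by (rule fps_ext) (simp add: fps_sum_nth F_eq[OF s] H_def)
    moreover have cr: "fps_conv_radius (fps_const (M s t) * fps_shift d (H t)) = \<infinity>" if "t \<in> I" for t
      using fps_conv_radius_mult[of "fps_const (M s t)" "fps_shift d (H t)"] H[OF that] by simp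
    ultimately show ?thesis
      using eval_fps_sum[OF I cr] G[OF s] H by (simp add: X_def eval_fps_add eval_fps_mult)
  qed
  have "isolated_singularity_at (X s) 0" if "s \<in> I" for s
  proof -
    have "eval_fps (F s) holomorphic_on UNIV" by (intro holomorphic_on_eval_fps) (simp add: F that)
    hence "(eval_fps (F s) \<circ> inverse) holomorphic_on - {0}"
      by (rule holomorphic_on_compose_gen[rotated]) (auto intro!: holomorphic_intros)
    hence "X s analytic_on - {0}"
      by (subst analytic_on_open) (auto simp: X_def o_def open_Compl)
    thus ?thesis
      unfolding isolated_singularity_at_def
      by (intro exI[of _ 1]) (auto elim: analytic_on_subset)
  qed
  moreover have "h s analytic_on {0}" if "s \<in> I" for s
    unfolding h_def using h0[OF that] by (intro analytic_intros) auto
  moreover have "\<forall>\<^sub>F z in at 0. X s z = z ^ d * (\<Sum>t\<in>I. M s t * X t (q * z)) + f s z + h s z"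
    if s: "s \<in> I" for s
  proof -
    have "\<forall>\<^sub>F z in at (0::complex). z \<noteq> 0" by (simp add: eventually_at_filter)
    with f_eq[OF s] show ?thesis
    proof eventually_elim
      case (elim z)
      have "z ^ d * (\<Sum>t\<in>I. M s t * X t (q * z)) =
          (\<Sum>t\<in>I. M s t * (z ^ d * eval_fps (H t) (inverse z)))"
        by (simp add: X_scale sum_distrib_left mult_ac)
      also have "\<dots> = (\<Sum>t\<in>I. M s t * eval_fps (fps_shift d (H t)) (inverse z)) +
          (\<Sum>t\<in>I. M s t * (\<Sum>m<d. fps_nth (H t) m * z ^ (d - m)))"
        using elim H by (simp add: power_mult_eval_fps_inverse distrib_left sum.distrib)
      finally show ?case
        using elim by (simp add: sumeq[OF s] h_def)
    qed
  qed
  ultimately show ?thesis by (rule that)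
qed

section \<open>Germs\<close>

lemma germ_rel_refl_iff [simp]: "germ_rel f f \<longleftrightarrow> isolated_singularity_at f 0"
  by (simp add: germ_rel_def)

lemma germ_representative:
  obtains f where "isolated_singularity_at f 0" "abs_germ f = g"
  using Quotient_rep_reflp[OF Quotient_germ, of g] Quotient_abs_rep[OF Quotient_germ, of g]
    germ_rel_refl_iff that by metis

lemma abs_germ_eqI:
  assumes "isolated_singularity_at f 0" "isolated_singularity_at g 0" "\<forall>\<^sub>F z in at 0. f z = g z"
  shows "abs_germ f = abs_germ g"
  using Quotient_rel_abs[OF Quotient_germ, of f g] assms by (simp add: germ_rel_def)

lemma isolated_singularity_at_sum:
  assumes "\<And>i. i \<in> I \<Longrightarrow> isolated_singularity_at (f i) 0"
  shows "isolated_singularity_at (\<lambda>z. \<Sum>i\<in>I. f i z) 0"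
  using assms
  by (induction I rule: infinite_finite_induct)
    (auto intro!: isolated_singularity_at_add isolated_singularity_at_const)

lemma abs_germ_sum:
  assumes "finite I" "\<And>i. i \<in> I \<Longrightarrow> isolated_singularity_at (f i) 0"
  shows "(\<Sum>i\<in>I. abs_germ (f i)) = abs_germ (\<lambda>z. \<Sum>i\<in>I. f i z)"
  using assms
  by (induction I rule: finite_induct)
    (auto simp: zero_germ.abs_eq plus_germ.abs_eq isolated_singularity_at_sum)

lemma isolated_singularity_at_scale:
  assumes "isolated_singularity_at f 0" "q \<noteq> 0"
  shows "isolated_singularity_at (\<lambda>z. f (q * z)) 0"
  by (rule isolated_singularity_at_compose) (use assms in \<open>simp_all add: analytic_on_mult\<close>)

lemma const_germ_hom [simp]:
  "const_germ 0 = 0" "const_germ 1 = 1"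
  "const_germ (a + b) = const_germ a + const_germ b" "const_germ (a * b) = const_germ a * const_germ b"
  by (transfer; simp add: germ_rel_def isolated_singularity_at_const)+

lemma const_germ_sum: "const_germ (\<Sum>i\<in>I. f i) = (\<Sum>i\<in>I. const_germ (f i))"
  by (induction I rule: infinite_finite_induct) auto

lemma z_powi_germ_add: "z_powi_germ (m + n) = z_powi_germ m * z_powi_germ n"
proof -
  have "isolated_singularity_at (\<lambda>z. z powi m) 0" for m
    by (auto intro!: isolated_singularity_at_powr isolated_singularity_at_id simp: eventually_at_filter)
  thus ?thesis
    by transfer (auto simp: germ_rel_def power_int_add eventually_at_filter intro!: isolated_singularity_at_times)
qed

lemma z_powi_germ_0 [simp]: "z_powi_germ 0 = 1"
  by transfer (simp add: germ_rel_def isolated_singularity_at_const)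

lemma sigma_0 [simp]: "sigma q 0 = 0"
  by transfer (auto simp: germ_rel_def isolated_singularity_at_const)

lemma sigma_1 [simp]: "q \<noteq> 0 \<Longrightarrow> sigma q 1 = 1"
  by transfer (auto simp: germ_rel_def isolated_singularity_at_const)

text \<open>
  All errors in the block equations have this shape. The power of \<open>z\<close> goes into the numerator
  or the denominator, according to the sign of \<open>m\<close>; one of \<open>nat m\<close> and \<open>nat (- m)\<close> is \<open>0\<close>.
\<close>

lemma z_powi_germ_times_analytic_mem_convergent_fractions:
  assumes h: "h analytic_on {0}"
  shows "z_powi_germ m * abs_germ h \<in> convergent_fractions"
proof -
  have iso: "isolated_singularity_at h 0" using h by (rule isolated_singularity_at_analytic)
  have isom: "isolated_singularity_at (\<lambda>z. z powi m) (0::complex)"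
    by (auto intro!: isolated_singularity_at_powr isolated_singularity_at_id simp: eventually_at_filter)
  define A where "A = fps_expansion h 0"
  have A: "h has_fps_expansion A" unfolding A_def using h by (rule analytic_at_imp_has_fps_expansion_0)
  hence crA: "fps_conv_radius A > 0" and evA: "\<forall>\<^sub>F z in nhds 0. eval_fps A z = h z"
    by (auto simp: has_fps_expansion_def)
  define a b where "a = A * fps_X ^ nat m" and "b = (fps_X ^ nat (- m) :: complex fps)"
  have X: "fps_conv_radius (fps_X ^ n :: complex fps) = \<infinity>" for n
    using fps_conv_radius_power[of "fps_X :: complex fps" n] by simp
  have cra: "fps_conv_radius a \<ge> fps_conv_radius A"
    unfolding a_def using fps_conv_radius_mult[of A "fps_X ^ nat m"] X by simp
  have "\<forall>\<^sub>F z in nhds 0. z \<in> eball (0::complex) (fps_conv_radius A)"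
    using crA by (intro eventually_nhds_in_open) (auto simp: zero_ereal_def)
  hence "\<forall>\<^sub>F z in at 0. z \<in> eball (0::complex) (fps_conv_radius A)"
    by (auto simp: eventually_at_filter elim: eventually_mono)
  moreover have "\<forall>\<^sub>F z in at 0. eval_fps A z = h z"
    using evA by (simp add: eventually_at_filter eventually_mono)
  moreover have "\<forall>\<^sub>F z in at (0::complex). z \<noteq> 0" by (simp add: eventually_at_filter)
  ultimately have "\<forall>\<^sub>F z in at 0. z powi m * h z = eval_fps a z / eval_fps b z"
  proof eventually_elim
    case (elim z)
    have "eval_fps a z = h z * z ^ nat m"
      using elim by (simp add: a_def eval_fps_mult X)
    moreover have "eval_fps b z = z ^ nat (- m)" by (simp add: b_def)
    moreover have "z powi m = z ^ nat m / z ^ nat (- m)"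
      using elim by (cases "m \<ge> 0") (simp_all add: power_int_def field_simps)
    ultimately show ?case by simp
  qed
  moreover have "b \<noteq> 0" "fps_conv_radius b > 0" by (simp_all add: b_def X)
  moreover have "fps_conv_radius a > 0" using crA cra by (rule less_le_trans)
  moreover have "germ_rel (\<lambda>z. z powi m * h z) (\<lambda>z. z powi m * h z)"
    using iso isom by (simp add: isolated_singularity_at_times)
  ultimately have "is_convergent_fraction (abs_germ (\<lambda>z. z powi m * h z))"
    by (subst is_convergent_fraction.abs_eq) blast+
  moreover have "z_powi_germ m * abs_germ h = abs_germ (\<lambda>z. z powi m * h z)"
    using iso isom by (simp add: z_powi_germ.abs_eq times_germ.abs_eq)
  ultimately show ?thesis by (simp add: convergent_fractions_def)
qed

lemma germ_system_solvable_mod_analytic: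
  fixes M :: "'i \<Rightarrow> 'i \<Rightarrow> complex" and W :: "'i \<Rightarrow> germ"
  assumes I: "finite I" and d: "d > 0" and q: "norm q \<ge> 1"
  obtains X h where "\<And>s. s \<in> I \<Longrightarrow> h s analytic_on {0}"
    "\<And>s. s \<in> I \<Longrightarrow>
       X s = z_powi_germ (int d) * (\<Sum>t\<in>I. const_germ (M s t) * sigma q (X t)) + W s + abs_germ (h s)"
proof -
  have q0: "q \<noteq> 0" using q by auto
  obtain f where f: "\<And>s. isolated_singularity_at (f s) 0" "\<And>s. abs_germ (f s) = W s"
  proof -
    have "\<forall>s. \<exists>f. isolated_singularity_at f 0 \<and> abs_germ f = W s"
      by (meson germ_representative)
    with that show ?thesis by metis
  qed
  obtain X h where X: "\<And>s. s \<in> I \<Longrightarrow> isolated_singularity_at (X s) 0"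
    and h: "\<And>s. s \<in> I \<Longrightarrow> h s analytic_on {0}"
    and eq: "\<And>s. s \<in> I \<Longrightarrow> \<forall>\<^sub>F z in at 0. X s z = z ^ d * (\<Sum>t\<in>I. M s t * X t (q * z)) + f s z + h s z"
    using q_difference_system_solvable_mod_analytic[where M = M and f = f, OF I d q f(1)] by blast
  have "abs_germ (X s) = z_powi_germ (int d) *
      (\<Sum>t\<in>I. const_germ (M s t) * sigma q (abs_germ (X t))) + W s + abs_germ (h s)" if s: "s \<in> I" for s
  proof -
    have iso: "isolated_singularity_at (\<lambda>z. M s t * X t (q * z)) 0" if "t \<in> I" for t
      by (intro isolated_singularity_at_times isolated_singularity_at_const
          isolated_singularity_at_scale X that q0)
    have "(\<Sum>t\<in>I. const_germ (M s t) * sigma q (abs_germ (X t))) =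
        (\<Sum>t\<in>I. abs_germ (\<lambda>z. M s t * X t (q * z)))"
      using q0 X by (intro sum.cong refl)
        (simp add: sigma.abs_eq const_germ.abs_eq times_germ.abs_eq isolated_singularity_at_const
          isolated_singularity_at_scale)
    also have "\<dots> = abs_germ (\<lambda>z. \<Sum>t\<in>I. M s t * X t (q * z))"
      by (rule abs_germ_sum[OF I iso])
    finally have sm: "(\<Sum>t\<in>I. const_germ (M s t) * sigma q (abs_germ (X t))) = \<dots>" .
    have isom: "isolated_singularity_at (\<lambda>z. z ^ d) (0::complex)"
      by (intro isolated_singularity_at_analytic analytic_intros)
    have isos: "isolated_singularity_at (\<lambda>z. \<Sum>t\<in>I. M s t * X t (q * z)) 0"
      by (intro isolated_singularity_at_sum iso)
    have isoh: "isolated_singularity_at (h s) 0" using h[OF s] by (rule isolated_singularity_at_analytic)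
    show ?thesis
      unfolding sm f(2)[symmetric]
      using X[OF s] isos isom isoh f(1)[of s] eq[OF s]
      by (auto simp: z_powi_germ.abs_eq times_germ.abs_eq plus_germ.abs_eq isolated_singularity_at_times
          isolated_singularity_at_add intro!: abs_germ_eqI)
  qed
  with h show ?thesis by (intro that[of h "\<lambda>s. abs_germ (X s)"])
qed

section \<open>The equation for a single block\<close>

lemma invertible_mat_entries:
  fixes P :: "complex mat"
  assumes P: "P \<in> carrier_mat n n" "invertible_mat P"
  obtains Q where "\<And>a b. a < n \<Longrightarrow> b < n \<Longrightarrow> (\<Sum>c<n. P $$ (a, c) * Q $$ (c, b)) = (if a = b then 1 else 0)"
proof -
  from P obtain Q where "inverts_mat P Q" "inverts_mat Q P" by (auto simp: invertible_mat_def)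
  hence PQ: "P * Q = 1\<^sub>m n" and QP: "Q * P = 1\<^sub>m (dim_row Q)"
    using P by (auto simp: inverts_mat_def)
  have "dim_col Q = n" using arg_cong[OF PQ, of dim_col] by simp
  moreover have "dim_row Q = n" using arg_cong[OF QP, of dim_col] P by simp
  ultimately have Q: "Q \<in> carrier_mat n n" by auto
  have "(\<Sum>c<n. P $$ (a, c) * Q $$ (c, b)) = (if a = b then 1 else 0)" if "a < n" "b < n" for a b
    using arg_cong[OF PQ, of "\<lambda>M. M $$ (a, b)"] that P Q
    by (simp add: scalar_prod_def lessThan_atLeast0)
  thus ?thesis by (rule that)
qed

text \<open>
  With \<open>Q\<close> the inverse of \<open>P\<close>, the equation amounts to
  \<open>X = z\<^sup>\<mu>\<^sup>-\<^sup>\<nu> Q (\<sigma>\<^sub>q X) B + z\<^sup>\<mu> Q W - z\<^sup>\<mu> Q V\<close>. Up to the last term this is a system for the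
  \<open>m n\<close> entries of \<open>X\<close>, with the Kronecker product of \<open>Q\<close> and the transpose of \<open>B\<close> as its matrix
  \<open>M\<close>. It is solvable up to an analytic error \<open>h\<close>, and \<open>V\<close> must then be \<open>- z\<^sup>-\<^sup>\<mu> P h\<close>.
\<close>

lemma Sylvester_q_difference_equation_solvable:
  fixes P B :: "complex mat" and W :: "nat \<Rightarrow> nat \<Rightarrow> germ" and \<mu> \<nu> :: int
  assumes P: "P \<in> carrier_mat m m" "invertible_mat P" and \<mu>: "\<mu> > \<nu>" and q: "norm q \<ge> 1"
  shows "\<exists>X V. \<forall>a<m. \<forall>b<n. V a b \<in> convergent_fractions \<and>
      (\<Sum>c<n. sigma q (X a c) * (z_powi_germ (- \<nu>) * const_germ (B $$ (c, b)))) + W a b =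
      V a b + (\<Sum>c<m. z_powi_germ (- \<mu>) * const_germ (P $$ (a, c)) * X c b)"
proof -
  obtain Q where Q: "\<And>a b. a < m \<Longrightarrow> b < m \<Longrightarrow>
      (\<Sum>c<m. P $$ (a, c) * Q $$ (c, b)) = (if a = b then 1 else 0)"
    using invertible_mat_entries[OF P] by metis
  have Qg: "(\<Sum>c<m. const_germ (P $$ (a, c)) * const_germ (Q $$ (c, b))) = (if a = b then 1 else 0)"
    if "a < m" "b < m" for a b
    using arg_cong[OF Q[OF that], of const_germ] by (simp add: const_germ_sum split: if_splits)
  have PQ: "(\<Sum>c<m. const_germ (P $$ (a, c)) * (\<Sum>c'<m. const_germ (Q $$ (c, c')) * Y c')) = Y a"
    if "a < m" for a and Y :: "nat \<Rightarrow> germ"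
  proof -
    have "(\<Sum>c<m. const_germ (P $$ (a, c)) * (\<Sum>c'<m. const_germ (Q $$ (c, c')) * Y c')) =
        (\<Sum>c'<m. (\<Sum>c<m. const_germ (P $$ (a, c)) * const_germ (Q $$ (c, c'))) * Y c')"
      unfolding sum_distrib_left sum_distrib_right by (subst sum.swap) (simp add: mult.assoc)
    also have "\<dots> = (\<Sum>c'<m. if c' = a then Y c' else 0)"
      using that by (intro sum.cong refl) (simp add: Qg)
    also have "\<dots> = Y a" using that by simp
    finally show ?thesis .
  qed
  define d where "d = nat (\<mu> - \<nu>)"
  have d: "d > 0" "int d = \<mu> - \<nu>" using \<mu> by (auto simp: d_def)
  define I where "I = {..<m} \<times> {..<n}"
  have finI: "finite I" by (simp add: I_def)
  have sumI: "(\<Sum>t\<in>I. g t) = (\<Sum>c<m. \<Sum>e<n. g (c, e))" for g :: "nat \<times> nat \<Rightarrow> germ"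
    by (simp add: I_def sum.cartesian_product)
  define M where "M = (\<lambda>(a, b) (c, e). Q $$ (a, c) * B $$ (e, b))"
  define W' where "W' = (\<lambda>(a, b). z_powi_germ \<mu> * (\<Sum>c<m. const_germ (Q $$ (a, c)) * W c b))"
  obtain X h where h: "\<And>s. s \<in> I \<Longrightarrow> h s analytic_on {0}"
    and X: "\<And>s. s \<in> I \<Longrightarrow>
       X s = z_powi_germ (int d) * (\<Sum>t\<in>I. const_germ (M s t) * sigma q (X t)) + W' s + abs_germ (h s)"
    by (rule germ_system_solvable_mod_analytic[where M = M and W = W', OF finI d(1) q])
      (rule that)
  define V where "V = (\<lambda>a b. z_powi_germ (- \<mu>) * abs_germ (\<lambda>z. \<Sum>c<m. - P $$ (a, c) * h (c, b) z))"
  have "V a b \<in> convergent_fractions \<and>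
      (\<Sum>c<n. sigma q (X (a, c)) * (z_powi_germ (- \<nu>) * const_germ (B $$ (c, b)))) + W a b =
      V a b + (\<Sum>c<m. z_powi_germ (- \<mu>) * const_germ (P $$ (a, c)) * X (c, b))"
    if a: "a < m" and b: "b < n" for a b
  proof
    have hc: "h (c, b) analytic_on {0}" if "c < m" for c using h that b by (auto simp: I_def)
    show "V a b \<in> convergent_fractions"
      unfolding V_def by (intro z_powi_germ_times_analytic_mem_convergent_fractions analytic_intros)
        (use hc in auto)
    define S where "S = (\<lambda>c. \<Sum>e<n. sigma q (X (c, e)) * const_germ (B $$ (e, b)))"
    have Xc: "X (c, b) = z_powi_germ (\<mu> - \<nu>) * (\<Sum>c'<m. const_germ (Q $$ (c, c')) * S c') +
        z_powi_germ \<mu> * (\<Sum>c'<m. const_germ (Q $$ (c, c')) * W c' b) + abs_germ (h (c, b))"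
      if "c < m" for c
    proof -
      have "(\<Sum>t\<in>I. const_germ (M (c, b) t) * sigma q (X t)) = (\<Sum>c'<m. const_germ (Q $$ (c, c')) * S c')"
        by (simp add: sumI S_def M_def sum_distrib_left mult_ac)
      thus ?thesis using X[of "(c, b)"] that b d by (simp add: I_def W'_def)
    qed
    have Vab: "V a b = - (z_powi_germ (- \<mu>) * (\<Sum>c<m. const_germ (P $$ (a, c)) * abs_germ (h (c, b))))"
    proof -
      have "abs_germ (\<lambda>z. \<Sum>c<m. - P $$ (a, c) * h (c, b) z) =
          (\<Sum>c<m. abs_germ (\<lambda>z. - P $$ (a, c) * h (c, b) z))"
        using hc by (intro abs_germ_sum[symmetric] isolated_singularity_at_analytic analytic_intros) auto
      also have "\<dots> = (\<Sum>c<m. - (const_germ (P $$ (a, c)) * abs_germ (h (c, b))))"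
        using hc by (intro sum.cong refl)
          (simp add: const_germ.abs_eq times_germ.abs_eq uminus_germ.abs_eq isolated_singularity_at_const
            isolated_singularity_at_times isolated_singularity_at_analytic)
      finally show ?thesis by (simp add: V_def sum_negf)
    qed
    have "(\<Sum>c<m. z_powi_germ (- \<mu>) * const_germ (P $$ (a, c)) * X (c, b)) =
        (\<Sum>c<m. (z_powi_germ (- \<mu>) * z_powi_germ (\<mu> - \<nu>)) *
             (const_germ (P $$ (a, c)) * (\<Sum>c'<m. const_germ (Q $$ (c, c')) * S c')) +
           (z_powi_germ (- \<mu>) * z_powi_germ \<mu>) *
             (const_germ (P $$ (a, c)) * (\<Sum>c'<m. const_germ (Q $$ (c, c')) * W c' b)) +
           z_powi_germ (- \<mu>) * (const_germ (P $$ (a, c)) * abs_germ (h (c, b))))"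
      by (intro sum.cong refl) (simp add: Xc algebra_simps)
    also have "\<dots> = (z_powi_germ (- \<mu>) * z_powi_germ (\<mu> - \<nu>)) * S a +
        (z_powi_germ (- \<mu>) * z_powi_germ \<mu>) * W a b - V a b"
      by (simp add: sum.distrib sum_distrib_left[symmetric] PQ[OF a] Vab)
    also have "\<dots> = z_powi_germ (- \<nu>) * S a + W a b - V a b"
      by (simp add: z_powi_germ_add[symmetric])
    finally show "(\<Sum>c<n. sigma q (X (a, c)) * (z_powi_germ (- \<nu>) * const_germ (B $$ (c, b)))) + W a b =
      V a b + (\<Sum>c<m. z_powi_germ (- \<mu>) * const_germ (P $$ (a, c)) * X (c, b))"
      by (simp add: S_def sum_distrib_left mult_ac)
  qed
  thus ?thesis by (intro exI[of _ "\<lambda>a b. X (a, b)"] exI[of _ V]) auto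
qed

section \<open>Block triangular matrices\<close>

lemma sum_over_block_positions:
  fixes f :: "nat \<Rightarrow> 'a::comm_monoid_add"
  shows "(\<Sum>t<(\<Sum>i<k. r i). f t) = (\<Sum>l<k. \<Sum>c<r l. f (block_start r l + c))"
proof (induction k)
  case (Suc k)
  have "(\<Sum>t<N + m. f t) = (\<Sum>t<N. f t) + (\<Sum>c<m. f (N + c))" for N m :: nat
    by (induction m) (auto simp: add.assoc)
  thus ?case by (simp add: Suc block_start_def)
qed simp

lemma sum_blocks_between:
  fixes g :: "nat \<Rightarrow> 'a::comm_monoid_add"
  assumes "i < j" "j < k" "\<And>l. l < k \<Longrightarrow> l < i \<or> j < l \<Longrightarrow> g l = 0"
  shows "(\<Sum>l<k. g l) = g i + (\<Sum>l\<in>{i<..<j}. g l) + g j"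
proof -
  have "(\<Sum>l<k. g l) = (\<Sum>l\<in>insert i (insert j {i<..<j}). g l)"
  proof (intro sum.mono_neutral_right ballI)
    fix l assume "l \<in> {..<k} - insert i (insert j {i<..<j})"
    hence "l < k" "l < i \<or> j < l" by auto
    thus "g l = 0" by (rule assms)
  qed (use assms in auto)
  thus ?thesis using assms by (simp add: add_ac)
qed

lemma index_upper_block_mat:
  assumes "i < k" "j < k" "a < r i" "b < r j"
  shows "upper_block_mat k r D U $$ (block_start r i + a, block_start r j + b) =
     (if i = j then D i $$ (a, b) else if i < j then U i j $$ (a, b) else 0)"
  using assms by (simp add: upper_block_mat_def index_block_mat)

lemma upper_block_mat_carrier [simp]:
  "upper_block_mat k r D U \<in> carrier_mat (\<Sum>i<k. r i) (\<Sum>i<k. r i)"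
  by (simp add: upper_block_mat_def block_mat_def)

lemma upper_block_mat_cong:
  assumes "\<And>i a b. i < k \<Longrightarrow> a < r i \<Longrightarrow> b < r i \<Longrightarrow> D i $$ (a, b) = D' i $$ (a, b)"
    and "\<And>i j a b. i < j \<Longrightarrow> j < k \<Longrightarrow> a < r i \<Longrightarrow> b < r j \<Longrightarrow> U i j $$ (a, b) = U' i j $$ (a, b)"
  shows "upper_block_mat k r D U = upper_block_mat k r D' U'"
proof (rule eq_matI)
  fix p s assume "p < dim_row (upper_block_mat k r D' U')" "s < dim_col (upper_block_mat k r D' U')"
  hence "p < (\<Sum>i<k. r i)" "s < (\<Sum>i<k. r i)" by (simp_all add: upper_block_mat_def block_mat_def)
  then obtain i a j b where "i < k" "a < r i" "p = block_start r i + a"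
    "j < k" "b < r j" "s = block_start r j + b"
    by (elim block_position)
  thus "upper_block_mat k r D U $$ (p, s) = upper_block_mat k r D' U' $$ (p, s)"
    using assms by (auto simp: index_upper_block_mat)
qed (simp_all add: upper_block_mat_def block_mat_def)

lemma upper_block_mat_mult:
  fixes D D' :: "nat \<Rightarrow> 'a::semiring_0 mat"
  shows "upper_block_mat k r D U * upper_block_mat k r D' U' =
    upper_block_mat k r (\<lambda>i. mat (r i) (r i) (\<lambda>(a, b). \<Sum>c<r i. D i $$ (a, c) * D' i $$ (c, b)))
      (\<lambda>i j. mat (r i) (r j) (\<lambda>(a, b).
         (\<Sum>c<r i. D i $$ (a, c) * U' i j $$ (c, b)) +
         (\<Sum>l\<in>{i<..<j}. \<Sum>c<r l. U i l $$ (a, c) * U' l j $$ (c, b)) +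
         (\<Sum>c<r j. U i j $$ (a, c) * D' j $$ (c, b))))"
    (is "?P * ?Q = ?R")
proof (rule eq_matI)
  let ?n = "\<Sum>i<k. r i"
  have car: "?P \<in> carrier_mat ?n ?n" "?Q \<in> carrier_mat ?n ?n" "?R \<in> carrier_mat ?n ?n"
    by (rule upper_block_mat_carrier)+
  fix p s assume "p < dim_row ?R" "s < dim_col ?R"
  hence p: "p < ?n" and s: "s < ?n" using car by auto
  from p obtain i a where i: "i < k" "a < r i" "p = block_start r i + a" by (rule block_position)
  from s obtain j b where j: "j < k" "b < r j" "s = block_start r j + b" by (rule block_position)
  define g where "g = (\<lambda>l. \<Sum>c<r l. ?P $$ (p, block_start r l + c) * ?Q $$ (block_start r l + c, s))"
  have "(?P * ?Q) $$ (p, s) = (\<Sum>t<?n. ?P $$ (p, t) * ?Q $$ (t, s))"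
    using car p s by (simp add: scalar_prod_def lessThan_atLeast0)
  hence PQ: "(?P * ?Q) $$ (p, s) = (\<Sum>l<k. g l)"
    by (simp add: sum_over_block_positions g_def)
  have g: "g l = (\<Sum>c<r l.
       (if i = l then D i $$ (a, c) else if i < l then U i l $$ (a, c) else 0) *
       (if l = j then D' l $$ (c, b) else if l < j then U' l j $$ (c, b) else 0))" if "l < k" for l
    unfolding g_def i(3) j(3) using that i j by (intro sum.cong refl) (simp add: index_upper_block_mat)
  have g0: "g l = 0" if "l < k" "l < i \<or> j < l" for l
    using that by (auto simp: g)
  consider "j < i" | "i = j" | "i < j" by linarith
  thus "(?P * ?Q) $$ (p, s) = ?R $$ (p, s)"
  proof cases
    case 1
    hence "(\<Sum>l<k. g l) = 0" by (intro sum.neutral ballI g0) auto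
    thus ?thesis unfolding PQ using 1 i j by (simp add: index_upper_block_mat)
  next
    case 2
    hence "(\<Sum>l<k. g l) = (\<Sum>l\<in>{i}. g l)"
      using i by (intro sum.mono_neutral_right) (auto intro!: g0)
    thus ?thesis unfolding PQ using 2 i j by (simp add: index_upper_block_mat g)
  next
    case 3
    have "(\<Sum>l<k. g l) = g i + (\<Sum>l\<in>{i<..<j}. g l) + g j"
      using 3 j g0 by (intro sum_blocks_between) auto
    also have "(\<Sum>l\<in>{i<..<j}. g l) = (\<Sum>l\<in>{i<..<j}. \<Sum>c<r l. U i l $$ (a, c) * U' l j $$ (c, b))"
      using j by (intro sum.cong) (auto simp: g)
    finally show ?thesis unfolding PQ using 3 i j by (simp add: index_upper_block_mat g)
  qed
qed (simp_all add: upper_block_mat_def block_mat_def)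


text \<open>
  The equation for block \<open>(i, j)\<close> involves, besides the unknowns at \<open>(i, j)\<close>, only blocks
  \<open>(i, l)\<close> and \<open>(l, j)\<close> with \<open>i < l < j\<close>. So the blocks can be determined one superdiagonal after
  another, and later choices do not disturb the equations that hold already.
\<close>

lemma block_triangular_recursion:
  fixes \<sigma> :: "'a::comm_ring_1 \<Rightarrow> 'a" and D :: "nat \<Rightarrow> 'a mat" and U :: "nat \<Rightarrow> nat \<Rightarrow> 'a mat"
  assumes solve: "\<And>i j W. i < j \<Longrightarrow> j < k \<Longrightarrow> \<exists>X V. \<forall>a<r i. \<forall>b<r j. V a b \<in> S \<and>
      (\<Sum>c<r j. \<sigma> (X a c) * D j $$ (c, b)) + W a b = V a b + (\<Sum>c<r i. D i $$ (a, c) * X c b)"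
  shows "\<exists>F V. \<forall>i j. i < j \<and> j < k \<longrightarrow> (\<forall>a<r i. \<forall>b<r j. V i j a b \<in> S \<and>
      (\<Sum>c<r j. \<sigma> (F i j a c) * D j $$ (c, b)) +
        (U i j $$ (a, b) + (\<Sum>l\<in>{i<..<j}. \<Sum>c<r l. \<sigma> (F i l a c) * U l j $$ (c, b))) =
      V i j a b + (\<Sum>l\<in>{i<..<j}. \<Sum>c<r l. V i l a c * F l j c b) +
        (\<Sum>c<r i. D i $$ (a, c) * F i j c b))"
proof -
  define known where "known = (\<lambda>F V i j a b. U i j $$ (a, b) +
      (\<Sum>l\<in>{i<..<j}. \<Sum>c<r l. \<sigma> (F i l a c) * U l j $$ (c, b)) -
      (\<Sum>l\<in>{i<..<j}. \<Sum>c<r l. V i l a c * F l j c b))"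
  define solution where "solution = (\<lambda>i j W X Y. \<forall>a<r i. \<forall>b<r j. Y a b \<in> S \<and>
      (\<Sum>c<r j. \<sigma> (X a c) * D j $$ (c, b)) + W a b = Y a b + (\<Sum>c<r i. D i $$ (a, c) * X c b))"
  have solve': "\<exists>X Y. solution i j W X Y" if "i < j" "j < k" for i j W
    unfolding solution_def using that by (rule solve)
  define good where "good = (\<lambda>F V i j. solution i j (known F V i j) (F i j) (V i j))"
  have "\<exists>F V. \<forall>i j. i < j \<and> j < k \<and> j - i \<le> w \<longrightarrow> good F V i j" for w
  proof (induction w)
    case 0
    show ?case by (intro exI allI impI) auto
  next
    case (Suc w)
    then obtain F V where FV: "\<And>i j. i < j \<Longrightarrow> j < k \<Longrightarrow> j - i \<le> w \<Longrightarrow> good F V i j" by blast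
    have "\<forall>i j. \<exists>X Y. i < j \<and> j < k \<longrightarrow> solution i j (known F V i j) X Y"
      using solve' by blast
    then obtain X Y where XY: "\<And>i j. i < j \<Longrightarrow> j < k \<Longrightarrow> solution i j (known F V i j) (X i j) (Y i j)"
      unfolding choice_iff by blast
    define F' where "F' = (\<lambda>i j. if j - i \<le> w then F i j else X i j)"
    define V' where "V' = (\<lambda>i j. if j - i \<le> w then V i j else Y i j)"
    have known': "known F' V' i j = known F V i j" if "j - i \<le> Suc w" for i j
      unfolding known_def F'_def V'_def using that
      by (intro ext arg_cong2[of _ _ _ _ minus] arg_cong2[of _ _ _ _ plus] refl sum.cong) auto
    have "good F' V' i j" if "i < j" "j < k" "j - i \<le> Suc w" for i j
      using FV[OF that(1,2)] XY[OF that(1,2)] known'[OF that(3)]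
      by (cases "j - i \<le> w") (simp_all add: good_def F'_def V'_def)
    thus ?case by blast
  qed
  from this[of k] obtain F V where "\<forall>i j. i < j \<and> j < k \<and> j - i \<le> k \<longrightarrow> good F V i j"
    by blast
  hence "\<forall>i j. i < j \<and> j < k \<longrightarrow> good F V i j" by auto
  hence FV: "V i j a b \<in> S \<and> (\<Sum>c<r j. \<sigma> (F i j a c) * D j $$ (c, b)) + known F V i j a b =
        V i j a b + (\<Sum>c<r i. D i $$ (a, c) * F i j c b)"
    if "i < j \<and> j < k" "a < r i" "b < r j" for i j a b
    using that by (simp add: good_def solution_def)
  have move: "x + (u + s - v) = y + w \<longleftrightarrow> x + (u + s) = y + v + w" for x u s v y w :: 'a
    by (auto simp: algebra_simps)
  show ?thesis
    by (intro exI allI impI) (rule FV[unfolded known_def move])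
qed

theorem corollary2p10:
  fixes q :: complex and k :: nat and r :: "nat \<Rightarrow> nat" and \<mu> :: "nat \<Rightarrow> int"
    and A :: "nat \<Rightarrow> complex mat" and U :: "nat \<Rightarrow> nat \<Rightarrow> germ mat"
  assumes "norm q > 1"
    and "k \<ge> 1"
    and "\<And>i j. i < j \<Longrightarrow> j < k \<Longrightarrow> \<mu> i > \<mu> j"
    and "\<And>i. i < k \<Longrightarrow> r i \<ge> 1"
    and "\<And>i. i < k \<Longrightarrow> A i \<in> carrier_mat (r i) (r i) \<and> invertible_mat (A i)"
    and "U \<in> upper_families k r UNIV"
  shows "\<exists>F \<in> unipotent_group k r. \<exists>V \<in> upper_families k r convergent_fractions.
           gauge_transform q F (A_mat k r \<mu> A U) = A_mat k r \<mu> A V"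
proof -
  define n where "n = (\<Sum>i<k. r i)"
  define D where "D = (\<lambda>i. z_powi_germ (- \<mu> i) \<cdot>\<^sub>m map_mat const_germ (A i))"
  have q: "norm q \<ge> 1" "q \<noteq> 0" using assms(1) by auto
  have D: "D i $$ (a, b) = z_powi_germ (- \<mu> i) * const_germ (A i $$ (a, b))"
    if "i < k" "a < r i" "b < r i" for i a b
    using carrier_matD[of "A i" "r i" "r i"] assms(5)[OF that(1)] that by (simp add: D_def)
  have solve: "\<exists>X V. \<forall>a<r i. \<forall>b<r j. V a b \<in> convergent_fractions \<and>
      (\<Sum>c<r j. sigma q (X a c) * D j $$ (c, b)) + W a b = V a b + (\<Sum>c<r i. D i $$ (a, c) * X c b)"
    if ij: "i < j" "j < k" for i j and W :: "nat \<Rightarrow> nat \<Rightarrow> germ"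
  proof -
    have i: "i < k" using ij by simp
    have "A i \<in> carrier_mat (r i) (r i)" "invertible_mat (A i)" using assms(5)[OF i] by auto
    from Sylvester_q_difference_equation_solvable
      [where n = "r j" and W = W and B = "A j", OF this assms(3)[OF ij] q(1)]
    show ?thesis using D i ij by simp
  qed
  obtain F V where FV: "\<And>i j a b. i < j \<Longrightarrow> j < k \<Longrightarrow> a < r i \<Longrightarrow> b < r j \<Longrightarrow>
      V i j a b \<in> convergent_fractions \<and>
      (\<Sum>c<r j. sigma q (F i j a c) * D j $$ (c, b)) +
        (U i j $$ (a, b) + (\<Sum>l\<in>{i<..<j}. \<Sum>c<r l. sigma q (F i l a c) * U l j $$ (c, b))) =
      V i j a b + (\<Sum>l\<in>{i<..<j}. \<Sum>c<r l. V i l a c * F l j c b) +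
        (\<Sum>c<r i. D i $$ (a, c) * F i j c b)"
    using block_triangular_recursion[of k r convergent_fractions "sigma q" D U, OF solve] by blast
  define FB where "FB = (\<lambda>i j. mat (r i) (r j) (\<lambda>(a, b). F i j a b))"
  define VB where "VB = (\<lambda>i j. mat (r i) (r j) (\<lambda>(a, b). V i j a b))"
  define \<Phi> where "\<Phi> = upper_block_mat k r (\<lambda>i. 1\<^sub>m (r i)) FB"
  have \<Phi>: "\<Phi> \<in> unipotent_group k r"
    by (auto simp: \<Phi>_def unipotent_group_def upper_families_def FB_def)
  have VB: "VB \<in> upper_families k r convergent_fractions"
    using FV by (auto simp: upper_families_def VB_def elements_mat_def)
  have sigma_\<Phi>: "map_mat (sigma q) \<Phi> = upper_block_mat k r (\<lambda>i. 1\<^sub>m (r i)) (\<lambda>i j. map_mat (sigma q) (FB i j))"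
  proof (rule eq_matI)
    fix p s assume "p < dim_row (upper_block_mat k r (\<lambda>i. 1\<^sub>m (r i)) (\<lambda>i j. map_mat (sigma q) (FB i j)))"
      "s < dim_col (upper_block_mat k r (\<lambda>i. 1\<^sub>m (r i)) (\<lambda>i j. map_mat (sigma q) (FB i j)))"
    hence ps: "p < (\<Sum>i<k. r i)" "s < (\<Sum>i<k. r i)" by (simp_all add: upper_block_mat_def block_mat_def)
    from ps(1) obtain i a where i: "i < k" "a < r i" "p = block_start r i + a" by (rule block_position)
    from ps(2) obtain j b where j: "j < k" "b < r j" "s = block_start r j + b" by (rule block_position)
    have "map_mat (sigma q) \<Phi> $$ (p, s) = sigma q (\<Phi> $$ (p, s))"
      using ps by (simp add: \<Phi>_def upper_block_mat_def block_mat_def)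
    thus "map_mat (sigma q) \<Phi> $$ (p, s) =
        upper_block_mat k r (\<lambda>i. 1\<^sub>m (r i)) (\<lambda>i j. map_mat (sigma q) (FB i j)) $$ (p, s)"
      unfolding \<Phi>_def i(3) j(3) using i j q
      by (cases "i = j") (auto simp: index_upper_block_mat FB_def)
  qed (simp_all add: \<Phi>_def upper_block_mat_def block_mat_def)
  have intertwine: "map_mat (sigma q) \<Phi> * A_mat k r \<mu> A U = A_mat k r \<mu> A VB * \<Phi>"
    unfolding sigma_\<Phi> A_mat_def D_def[symmetric] unfolding \<Phi>_def upper_block_mat_mult
  proof (rule upper_block_mat_cong)
    fix i a b assume "i < k" "a < r i" "b < r i"
    thus "mat (r i) (r i) (\<lambda>(a, b). \<Sum>c<r i. 1\<^sub>m (r i) $$ (a, c) * D i $$ (c, b)) $$ (a, b) =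
        mat (r i) (r i) (\<lambda>(a, b). \<Sum>c<r i. D i $$ (a, c) * 1\<^sub>m (r i) $$ (c, b)) $$ (a, b)"
      by (simp add: if_distrib[of "\<lambda>x. x * _"] if_distrib[of "\<lambda>x. _ * x"] cong: if_cong)
  next
    fix i j a b assume ij: "i < j" "j < k" "a < r i" "b < r j"
    have 1: "(\<Sum>c<r i. (if a = c then 1 else 0) * U i j $$ (c, b)) = U i j $$ (a, b)"
      using ij by (simp add: if_distrib[of "\<lambda>x. x * _"] cong: if_cong)
    have 2: "(\<Sum>c<r j. V i j a c * (if c = b then 1 else 0)) = V i j a b"
      using ij by (simp add: if_distrib[of "\<lambda>x. _ * x"] cong: if_cong)
    show "mat (r i) (r j) (\<lambda>(a, b).
          (\<Sum>c<r i. 1\<^sub>m (r i) $$ (a, c) * U i j $$ (c, b)) +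
          (\<Sum>l\<in>{i<..<j}. \<Sum>c<r l. map_mat (sigma q) (FB i l) $$ (a, c) * U l j $$ (c, b)) +
          (\<Sum>c<r j. map_mat (sigma q) (FB i j) $$ (a, c) * D j $$ (c, b))) $$ (a, b) =
        mat (r i) (r j) (\<lambda>(a, b).
          (\<Sum>c<r i. D i $$ (a, c) * FB i j $$ (c, b)) +
          (\<Sum>l\<in>{i<..<j}. \<Sum>c<r l. VB i l $$ (a, c) * FB l j $$ (c, b)) +
          (\<Sum>c<r j. VB i j $$ (a, c) * 1\<^sub>m (r j) $$ (c, b))) $$ (a, b)"
      using ij FV[OF ij] by (simp add: 1 2 FB_def VB_def add_ac)
  qed
  have car: "A_mat k r \<mu> A VB \<in> carrier_mat n n" "\<Phi> \<in> carrier_mat n n"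
    unfolding A_mat_def \<Phi>_def n_def by (rule upper_block_mat_carrier)+
  have inv: "inv_mat \<Phi> \<in> carrier_mat n n" "\<Phi> * inv_mat \<Phi> = 1\<^sub>m n"
    using unipotent_group_inverse[OF \<Phi>] by (auto simp: n_def)
  have "gauge_transform q \<Phi> (A_mat k r \<mu> A U) = A_mat k r \<mu> A VB"
    unfolding gauge_transform_def intertwine assoc_mult_mat[OF car inv(1)] inv(2)
    using car by simp
  with \<Phi> VB show ?thesis by blast
qed

end
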